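(* Let $n$ be a positive even integer. Then there is a balanced Gray code for $\mathcal{P}^{\mathrm{cadj}}_n$: a cyclic listing of all $n!$ permutations of $[n]$ in which consecutive permutations (including the last and the first) differ by a cyclically adjacent transposition, and each of the $n$ cyclically adjacent transpositions is used exactly $\frac{n!}{n}=(n-1)!$ times.
   Context: $S_n$ is the set of permutations of $[n]$ in one-line notation $\pi_1\cdots\pi_n$; applying a transposition $(i,j)$ interchanges the entries $i$ and $j$. The cyclically adjacent transpositions are $(i,i+1)$ for $i\in[n-1]$ together with $(1,n)$. $\mathcal{P}^{\mathrm{cadj}}_n$ is the graph on $S_n$ in which two permutations are adjacent iff they differ by a cyclically adjacent transposition, edges being colored by that transposition. *)

theory Defs
  imports Complex_Main "HOL-Combinatorics.Permutations"
begin

definition perms :: "nat \<Rightarrow> (nat \<Rightarrow> nat) set" where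
  "perms n = {p. p permutes {1..n}}"

(* Color i < n stands for the transposition (i, i+1), color n for (1, n). The family is
   indexed by [n]; the index determines the transposition, and conversely if n \<ge> 3
   (lemma below). Only for n = 2 do two colors, 1 and 2, denote the same transposition
   (1, 2); the two vertices are then joined by two parallel edges. *)
definition cadj_transp :: "nat \<Rightarrow> nat \<Rightarrow> nat \<Rightarrow> nat" where
  "cadj_transp n i = (if i = n then transpose 1 n else transpose i (i + 1))"

lemma inj_on_cadj_transp:
  assumes "n \<ge> 3"
  shows "inj_on (cadj_transp n) {1..n}"
proof (rule inj_onI)
  fix i j assume ij: "i \<in> {1..n}" "j \<in> {1..n}" "cadj_transp n i = cadj_transp n j"
  have "cadj_transp n i i = cadj_transp n j i" "cadj_transp n i j = cadj_transp n j j"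
    using ij(3) by simp_all
  then show "i = j"
    using ij(1,2) assms by (auto simp: cadj_transp_def transpose_def split: if_splits)
qed

(* Edges of the graph P^cadj_n. The one-line notation of p is p 1, ..., p n, and composing with
   the transposition on the right interchanges the entries at positions i and j. *)
definition cadj_edge :: "nat \<Rightarrow> nat \<Rightarrow> (nat \<Rightarrow> nat) \<Rightarrow> (nat \<Rightarrow> nat) \<Rightarrow> bool" where
  "cadj_edge n i p q \<longleftrightarrow> p \<in> perms n \<and> q \<in> perms n \<and> q = p \<circ> cadj_transp n i"

(* ps is the cyclic listing of permutations, and cs ! k the color of the edge leaving ps ! k. *)
definition cadj_gray_code :: "nat \<Rightarrow> (nat \<Rightarrow> nat) list \<Rightarrow> nat list \<Rightarrow> bool" where
  "cadj_gray_code n ps cs \<longleftrightarrow>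
     distinct ps \<and> set ps = perms n \<and>
     length cs = length ps \<and> set cs \<subseteq> {1..n} \<and>
     (\<forall>k<length ps. cadj_edge n (cs ! k) (ps ! k) (ps ! (Suc k mod length ps)))"

definition balanced_cadj_gray_code :: "nat \<Rightarrow> (nat \<Rightarrow> nat) list \<Rightarrow> nat list \<Rightarrow> bool" where
  "balanced_cadj_gray_code n ps cs \<longleftrightarrow>
     cadj_gray_code n ps cs \<and> (\<forall>i\<in>{1..n}. count_list cs i = fact (n - 1))"

lemma length_cadj_gray_code:
  assumes "cadj_gray_code n ps cs"
  shows "length ps = fact n"
  using assms card_permutations[of "{1..n}" n] distinct_card[of ps]
  by (simp add: cadj_gray_code_def perms_def)

(* Interchanging the values i and j, instead of the entries at positions i and j, means composing
   on the left. Inverting every permutation in the listing passes from one convention to the other. *)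
lemma cadj_edge_inv_iff:
  assumes p: "p \<in> perms n" and q: "q \<in> perms n"
  shows "cadj_edge n i (inv p) (inv q) \<longleftrightarrow> q = cadj_transp n i \<circ> p"
proof -
  have bp: "bij p" and bq: "bij q"
    using p q by (simp_all add: perms_def permutes_bij)
  have bt: "bij (cadj_transp n i)" and it: "inv (cadj_transp n i) = cadj_transp n i"
    by (simp_all add: cadj_transp_def)
  have "cadj_edge n i (inv p) (inv q) \<longleftrightarrow> inv q = inv p \<circ> cadj_transp n i"
    using p q by (simp add: cadj_edge_def perms_def permutes_inv)
  also have "inv p \<circ> cadj_transp n i = inv (cadj_transp n i \<circ> p)"
    using o_inv_distrib[OF bt bp] it by simp
  also have "inv q = inv (cadj_transp n i \<circ> p) \<longleftrightarrow> q = cadj_transp n i \<circ> p"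
    using bq bij_comp[OF bp bt] by (metis inv_inv_eq)
  finally show ?thesis .
qed

end

theory Submission
  imports Defs "HOL-Combinatorics.Orbits"
begin

text \<open>For \<open>n \<ge> 6\<close>, let the entry \<open>n\<close> travel around the circle by successive cyclically adjacent
  transpositions. After \<open>n - 1\<close> steps the whole word has been rotated by one position, so \<open>S\<^sub>n\<close> splits
  into cycles of length \<open>n (n - 1)\<close>, one for each cyclic arrangement of the other entries,
  and on them every color is used \<open>(n - 1)!\<close> times. Two arrangements that differ by an adjacent swap
  give two cycles joined by a 4-cycle with colors \<open>i, j, i, j\<close>, where \<open>i\<close> moves \<open>n\<close> and \<open>j\<close> is disjoint
  from \<open>i\<close>; exchanging its \<open>i\<close>-edges for its \<open>j\<close>-edges merges the two cycles. As \<open>n\<close> is even, the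
  cycles can be oriented by the sign of the arrangement so that all these merges respect the
  orientation. Rotating a cycle makes every pair \<open>(i, j)\<close> available at every merge, so
  the exchanges can be chosen to cancel: \<open>2 \<rightarrow> 4 \<rightarrow> 2\<close> in pairs, preceded by \<open>1 \<rightarrow> 3 \<rightarrow> 5 \<rightarrow> 1\<close> if the
  number of merges is odd. The 4-cycles used do not interfere because \<open>i\<close> determines \<open>j\<close>.
  The cases \<open>n = 2\<close> and \<open>n = 4\<close> are given by explicit codes.\<close>

section \<open>Cycles of functions and listings\<close>

text \<open>Precomposing with \<open>transpose v w\<close> exchanges the successors of
  \<open>v\<close> and \<open>w\<close>: the new cycle runs from \<open>f v\<close> through
  \<open>A\<close> to \<open>v\<close>, jumps to \<open>f w\<close> and runs through
  \<open>B\<close> to \<open>w\<close>.\<close>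

lemma cyclic_on_merge:
  assumes A: "cyclic_on f A" and B: "cyclic_on f B" and v: "v \<in> A" and w: "w \<in> B"
    and disj: "A \<inter> B = {}"
  shows "cyclic_on (f \<circ> transpose v w) (A \<union> B)"
proof -
  let ?g = "f \<circ> transpose v w"
  have reach: "A' \<subseteq> orbit ?g w'"
    if A': "cyclic_on f A'" "v' \<in> A'" "w' \<notin> A'" "transpose v w = transpose v' w'" for A' v' w'
  proof
    fix y assume "y \<in> A'"
    then have "y \<in> orbit f v'" using A' by (simp add: orbit_cyclic_eq3)
    then show "y \<in> orbit ?g w'"
    proof induction
      case base
      show ?case using orbit.base[of ?g w'] A'(4) by (simp add: comp_def)
    next
      case (step y)
      show ?case
      proof (cases "y = v'")
        case True
        then show ?thesis using orbit.base[of ?g w'] A'(4) by (simp add: comp_def)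
      next
        case False
        have "y \<in> A'" using step.hyps A'(1,2) by (simp add: orbit_cyclic_eq3)
        then have "?g y = f y" using False A'(3,4) by (auto simp: transpose_def)
        then show ?thesis using orbit.step[OF step.IH] by metis
      qed
    qed
  qed
  have Aw: "A \<subseteq> orbit ?g w" using reach[OF A v] w disj by auto
  have Bv: "B \<subseteq> orbit ?g v" using reach[OF B w] v disj by (auto simp: transpose_commute)
  have "orbit ?g w \<subseteq> A \<union> B"
  proof
    fix y assume "y \<in> orbit ?g w"
    then show "y \<in> A \<union> B"
      by induction
        (use v w in \<open>auto simp: transpose_def intro: cyclic_on_inI[OF A] cyclic_on_inI[OF B]\<close>)
  qed
  moreover have "B \<subseteq> orbit ?g w" using Bv Aw v by (blast intro: orbit_trans)
  ultimately have "A \<union> B = orbit ?g w" using Aw by blast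
  then show ?thesis using w by (blast intro: cyclic_on_singleI)
qed

lemma cyclic_listing:
  assumes "cyclic_on f V"
  obtains xs where "distinct xs" "set xs = V"
    "\<And>k. k < length xs \<Longrightarrow> xs ! (Suc k mod length xs) = f (xs ! k)"
proof -
  obtain x where x: "x \<in> V" "V = orbit f x" using assms unfolding cyclic_on_def by blast
  let ?d = "funpow_dist1 f x x"
  have self: "x \<in> orbit f x" using x by simp
  define xs where "xs = map (\<lambda>k. (f ^^ k) x) [0..<?d]"
  have "distinct xs" using inj_on_funpow_dist1[OF self] by (simp add: xs_def distinct_map del: upt_Suc)
  moreover have "set xs = V"
    using orbit_conv_funpow_dist1[OF self] x(2) by (simp add: xs_def del: upt_Suc)
  moreover have "xs ! (Suc k mod length xs) = f (xs ! k)" if k: "k < length xs" for k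
  proof (cases "Suc k = ?d")
    case True
    then have "f ((f ^^ k) x) = x" using funpow_dist1_prop[OF self] by (metis comp_apply funpow.simps(2))
    then show ?thesis using True k by (simp add: xs_def del: upt_Suc)
  next
    case False
    then show ?thesis using k by (simp add: xs_def del: upt_Suc)
  qed
  ultimately show thesis by (rule that)
qed

text \<open>Additive on both sides, so that no truncated subtraction is needed when the old color at
  \<open>v\<close> loses an occurrence.\<close>

lemma sum_of_bool_fun_upd:
  assumes "finite V" "v \<in> V"
  shows "(\<Sum>p\<in>V. of_bool ((h(v := b)) p = a)) + of_bool (h v = a)
       = (\<Sum>p\<in>V. of_bool (h p = a)) + (of_bool (b = a) :: nat)"
proof -
  have "(\<Sum>p\<in>V - {v}. of_bool ((h(v := b)) p = a)) = (\<Sum>p\<in>V - {v}. of_bool (h p = a) :: nat)"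
    by (rule sum.cong) auto
  then show ?thesis
    using sum.remove[OF assms, of "\<lambda>p. of_bool ((h(v := b)) p = a) :: nat"]
      sum.remove[OF assms, of "\<lambda>p. of_bool (h p = a) :: nat"] by simp
qed

lemma count_list_map_distinct:
  assumes "distinct xs"
  shows "count_list (map h xs) a = (\<Sum>p\<in>set xs. of_bool (h p = a))"
  using assms by (induction xs) auto

lemma balanced_cadj_gray_codeI:
  assumes cyc: "cyclic_on f (perms n)"
    and f: "\<And>p. p \<in> perms n \<Longrightarrow> f p = p \<circ> cadj_transp n (col p)"
    and col: "\<And>p. p \<in> perms n \<Longrightarrow> col p \<in> {1..n}"
    and bal: "\<And>a. a \<in> {1..n} \<Longrightarrow> (\<Sum>p\<in>perms n. of_bool (col p = a)) = (fact (n - 1) :: nat)"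
  shows "\<exists>ps cs. balanced_cadj_gray_code n ps cs"
proof -
  obtain ps where ps: "distinct ps" "set ps = perms n"
    "\<And>k. k < length ps \<Longrightarrow> ps ! (Suc k mod length ps) = f (ps ! k)"
    using cyclic_listing[OF cyc] by metis
  have "cadj_edge n (col (ps ! k)) (ps ! k) (ps ! (Suc k mod length ps))" if "k < length ps" for k
    using that ps nth_mem[OF that] cyclic_on_inI[OF cyc] f by (auto simp: cadj_edge_def)
  then have "balanced_cadj_gray_code n ps (map col ps)"
    using ps col bal
    by (auto simp: balanced_cadj_gray_code_def cadj_gray_code_def count_list_map_distinct)
  then show ?thesis by blast
qed

section \<open>Codes given by one-line words\<close>

definition oneline :: "nat list \<Rightarrow> nat \<Rightarrow> nat" where
  "oneline w x = (if x \<in> {1..length w} then w ! (x - 1) else x)"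

text \<open>Color \<open>k\<close> concerns positions \<open>k\<close> and \<open>k + 1\<close>,
  that is, list indices \<open>k - 1\<close> and \<open>k\<close>; the \<open>mod\<close> wraps the
  last color around to index 0.\<close>

definition swap_step :: "nat list \<Rightarrow> nat \<Rightarrow> nat list" where
  "swap_step w k = (let j = k mod length w in w[k - 1 := w ! j, j := w ! (k - 1)])"

lemma oneline_in_perms:
  assumes "distinct w" "set w = {1..n}"
  shows "oneline w \<in> perms n"
proof -
  have len: "length w = n" using distinct_card[OF assms(1)] assms(2) by simp
  have "oneline w permutes {1..n}"
  proof (rule inj_imp_permutes)
    show "inj_on (oneline w) {1..n}"
      using nth_eq_iff_index_eq[OF assms(1)] len by (auto simp: inj_on_def oneline_def)
    fix x assume "x \<in> {1..n}"
    then show "oneline w x \<in> {1..n}"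
      using nth_mem[of "x - 1" w] len unfolding assms(2) by (auto simp: oneline_def)
  qed (auto simp: oneline_def len)
  then show ?thesis by (simp add: perms_def)
qed

lemma oneline_inject:
  assumes "oneline w = oneline w'" "length w = length w'"
  shows "w = w'"
proof (rule nth_equalityI)
  fix i assume "i < length w"
  then show "w ! i = w' ! i" using fun_cong[OF assms(1), of "Suc i"] assms(2) by (simp add: oneline_def)
qed (fact assms(2))

lemma oneline_swap_step:
  assumes k: "k \<in> {1..n}" and len: "length w = n" "2 \<le> n"
  shows "oneline (swap_step w k) = oneline w \<circ> cadj_transp n k"
proof
  fix x
  show "oneline (swap_step w k) x = (oneline w \<circ> cadj_transp n k) x"
  proof (cases "k = n")
    case True
    then show ?thesis using len
      by (simp add: oneline_def swap_step_def cadj_transp_def transpose_def nth_list_update)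
  next
    case False
    with k obtain m where m: "k = Suc m" "Suc m < n" by (cases k) auto
    then show ?thesis using len
      by (cases x) (auto simp: oneline_def swap_step_def cadj_transp_def transpose_def nth_list_update)
  qed
qed

text \<open>For explicit words every condition can be evaluated. That all of \<open>perms n\<close>
  is reached follows by counting, from \<open>n!\<close> distinct words.\<close>

lemma balanced_gray_code_of_words:
  assumes n: "2 \<le> n" and ws: "distinct ws" "length ws = fact n"
    and w: "\<And>w. w \<in> set ws \<Longrightarrow> distinct w \<and> set w = {1..n}"
    and cs: "length cs = length ws" "set cs \<subseteq> {1..n}" and step: "rotate1 ws = map2 swap_step ws cs"
    and bal: "\<And>i. i \<in> {1..n} \<Longrightarrow> count_list cs i = fact (n - 1)"
  shows "\<exists>ps cs. balanced_cadj_gray_code n ps cs"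
proof -
  have len: "length w = n" if "w \<in> set ws" for w
    using w[OF that] distinct_card[of w] by simp
  have "inj_on oneline (set ws)" using oneline_inject len by (metis inj_onI)
  then have dist: "distinct (map oneline ws)" using ws(1) by (simp add: distinct_map)
  have "set (map oneline ws) \<subseteq> perms n" using oneline_in_perms w by auto
  moreover have "card (perms n) = fact n" unfolding perms_def by (rule card_permutations) auto
  moreover have "finite (perms n)" unfolding perms_def by (simp add: finite_permutations)
  ultimately have set: "set (map oneline ws) = perms n"
    using distinct_card[OF dist] ws(2) by (intro card_subset_eq) simp_all
  have "cadj_edge n (cs ! k) (map oneline ws ! k) (map oneline ws ! (Suc k mod length (map oneline ws)))"
    if k: "k < length (map oneline ws)" for k
  proof -
    have k': "k < length ws" "Suc k mod length ws < length ws" using k by (auto intro: mod_less_divisor)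
    have csk: "cs ! k \<in> {1..n}" by (rule subsetD[OF cs(2)], rule nth_mem) (use cs(1) k' in simp)
    have "ws ! (Suc k mod length ws) = rotate1 ws ! k" using k' by (simp add: nth_rotate1)
    also have "\<dots> = swap_step (ws ! k) (cs ! k)" unfolding step using k' cs(1) by simp
    finally have "oneline (ws ! (Suc k mod length ws)) = oneline (ws ! k) \<circ> cadj_transp n (cs ! k)"
      using oneline_swap_step[OF csk len[OF nth_mem[OF k'(1)]] n] by (simp only:)
    moreover have "oneline (ws ! i) \<in> perms n" if "i < length ws" for i
      using oneline_in_perms w nth_mem[OF that] by blast
    ultimately show ?thesis
      unfolding cadj_edge_def length_map nth_map[OF k'(1)] nth_map[OF k'(2)] using k' by blast
  qed
  then have "balanced_cadj_gray_code n (map oneline ws) cs"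
    unfolding balanced_cadj_gray_code_def cadj_gray_code_def
    using dist set cs bal by simp
  then show ?thesis by blast
qed

lemma balanced_gray_code_2: "\<exists>ps cs. balanced_cadj_gray_code 2 ps cs"
  by (rule balanced_gray_code_of_words[of 2 "[[1,2], [2,1]]" "[1,2]"])
    (auto simp: swap_step_def numeral_2_eq_2)

lemma atLeastAtMost_1_4: "{1..4} = {1, 2, 3, 4 :: nat}"
  by auto

text \<open>For \<open>n = 4\<close> there are only 24 / 12 = 2 cycles of the traveling entry, and a
  single merge cannot be balanced, so a code is checked directly.\<close>

lemma balanced_gray_code_4: "\<exists>ps cs. balanced_cadj_gray_code 4 ps cs"
proof (rule balanced_gray_code_of_words)
  let ?ws = "[[1,2,3,4], [2,1,3,4], [2,3,1,4], [3,2,1,4], [3,1,2,4], [1,3,2,4], [1,3,4,2], [2,3,4,1],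
     [3,2,4,1], [1,2,4,3], [2,1,4,3], [3,1,4,2], [3,4,1,2], [3,4,2,1], [1,4,2,3], [1,4,3,2],
     [2,4,3,1], [2,4,1,3], [4,2,1,3], [4,1,2,3], [4,1,3,2], [4,3,1,2], [4,3,2,1], [4,2,3,1]] :: nat list list"
  let ?cs = "[1, 2, 1, 2, 1, 3, 4, 1, 4, 1, 4, 2, 3, 4, 3, 4, 3, 1, 2, 3, 2, 3, 2, 4] :: nat list"
  show "distinct ?ws" by simp
  show "length ?ws = fact 4" by (simp add: fact_numeral)
  show "distinct w \<and> set w = {1..4}" if "w \<in> set ?ws" for w
    using that unfolding atLeastAtMost_1_4 by (simp, elim disjE) (simp_all, auto)
  show "length ?cs = length ?ws" by simp
  show "set ?cs \<subseteq> {1..4}" by simp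
  show "rotate1 ?ws = map2 swap_step ?ws ?cs" by (simp add: swap_step_def)
  show "count_list ?cs i = fact (4 - 1)" if "i \<in> {1..4}" for i
    using that unfolding atLeastAtMost_1_4 by (elim insertE) (simp_all add: fact_numeral)
qed simp

section \<open>Cyclic order of three positions\<close>

definition cyc3 :: "nat \<Rightarrow> nat \<Rightarrow> nat \<Rightarrow> bool" where
  "cyc3 x y z \<longleftrightarrow> x < y \<and> y < z \<or> y < z \<and> z < x \<or> z < x \<and> x < y"

text \<open>Here \<open>l\<close> stands for the position of the traveling entry. Away from
  \<open>l\<close> the swap is strictly increasing, as it only shifts the neighbor of
  \<open>l\<close> by one, into the place \<open>l\<close>.\<close>

lemma cyc3_transpose_Suc:
  assumes "l \<in> {k, Suc k}" "l \<notin> {x, y, z}"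
  defines "t \<equiv> transpose k (Suc k)"
  shows "cyc3 (t x) (t y) (t z) = cyc3 x y z"
proof -
  have "t u < t v \<longleftrightarrow> u < v" if "u \<noteq> l" "v \<noteq> l" for u v
  proof (cases "l = k")
    case True
    then show ?thesis using that by (auto simp: t_def transpose_def)
  next
    case False
    then have "l = Suc k" using assms(1) by simp
    then show ?thesis using that by (auto simp: t_def transpose_def)
  qed
  then show ?thesis using assms(2) by (simp add: cyc3_def)
qed

lemma cyc3_rotate: "cyc3 x y z = cyc3 y z x"
  unfolding cyc3_def by blast

text \<open>At most one of the three positions is an end. Exchanging 1 for \<open>n\<close> turns
  the least position into the greatest or back, which the cyclic order does not see.\<close>

lemma cyc3_transpose_ends:
  assumes "x \<noteq> y" "y \<noteq> z" "x \<noteq> z" "l \<in> {1, n}" "l \<notin> {x, y, z}" "{x, y, z} \<subseteq> {1..n}"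
  defines "t \<equiv> transpose 1 n"
  shows "cyc3 (t x) (t y) (t z) = cyc3 x y z"
proof -
  have ends: "cyc3 u v w = cyc3 u' v w" if "u \<in> {1, n}" "u' \<in> {1, n}" "1 < v" "v < n" "1 < w" "w < n" for u u' v w
  proof -
    have "cyc3 a v w \<longleftrightarrow> v < w" if "a \<in> {1, n}" for a
      using that \<open>1 < v\<close> \<open>v < n\<close> \<open>1 < w\<close> \<open>w < n\<close> by (elim insertE) (simp_all add: cyc3_def)
    then show ?thesis using that by blast
  qed
  have inner: "1 < v \<and> v < n" if "v \<in> {1..n}" "v \<notin> {1, n}" for v
    using that by (simp add: le_neq_implies_less order_less_le)
  have fixed: "t v = v" if "v \<notin> {1, n}" for v using that by (simp add: t_def transpose_def)
  have tE: "t v \<in> {1, n}" if "v \<in> {1, n}" for v using that by (auto simp: t_def transpose_def)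
  have one: "cyc3 (t u) (t v) (t w) = cyc3 u v w"
    if "u \<in> {1, n}" "{u, v, w} = {x, y, z}" "u \<noteq> v" "u \<noteq> w" for u v w
  proof -
    have "v \<notin> {1, n}" "w \<notin> {1, n}" using that assms(4,5) by blast+
    moreover have "v \<in> {1..n}" "w \<in> {1..n}" using that(2) assms(6) by blast+
    ultimately have vw: "1 < v \<and> v < n" "1 < w \<and> w < n" "t v = v" "t w = w"
      using inner fixed by blast+
    show ?thesis unfolding vw(3,4) using ends[OF tE[OF that(1)] that(1)] vw(1,2) by blast
  qed
  consider "x \<in> {1, n}" | "y \<in> {1, n}" | "z \<in> {1, n}" | "x \<notin> {1, n}" "y \<notin> {1, n}" "z \<notin> {1, n}"
    by blast
  then show ?thesis
  proof cases
    case 1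
    then show ?thesis by (rule one) (use assms in auto)
  next
    case 2
    have "cyc3 (t y) (t z) (t x) = cyc3 y z x" by (rule one[OF 2]) (use assms in auto)
    then show ?thesis using cyc3_rotate by blast
  next
    case 3
    have "cyc3 (t z) (t x) (t y) = cyc3 z x y" by (rule one[OF 3]) (use assms in auto)
    then show ?thesis using cyc3_rotate by blast
  next
    case 4
    then show ?thesis using fixed by metis
  qed
qed

lemma sum_eq_by_pairs:
  fixes F G :: "nat \<Rightarrow> nat"
  assumes "(\<Sum>t<m. F t) = (\<Sum>t<m. G t)"
    and "\<And>r. F (m + 2 * r) + F (Suc (m + 2 * r)) = G (m + 2 * r) + G (Suc (m + 2 * r))"
  shows "(\<Sum>t<m + 2 * q. F t) = (\<Sum>t<m + 2 * q. G t)"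
proof (induction q)
  case 0
  then show ?case using assms(1) by simp
next
  case (Suc q)
  then show ?case using assms(2)[of q] by simp
qed

section \<open>The cycles of the traveling entry\<close>

locale cadj_graph =
  fixes n :: nat
  assumes even_n: "even n" and n_ge: "6 \<le> n"
begin

section \<open>The circle of positions and the swaps along it\<close>

definition N :: "nat set" where "N = {1..n}"

abbreviation V :: "(nat \<Rightarrow> nat) set" where "V \<equiv> perms n"

abbreviation s :: "nat \<Rightarrow> nat \<Rightarrow> nat" where "s \<equiv> cadj_transp n"

text \<open>With \<open>rot\<close> as successor on the circle, color \<open>k\<close> always swaps
  \<open>k\<close> and \<open>rot k\<close> (\<open>s_eq\<close>), so that color \<open>n\<close> is
  no exception.\<close>

definition rot :: "nat \<Rightarrow> nat" where
  "rot k = (if k = n then 1 else if k \<in> N then k + 1 else k)"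

definition unrot :: "nat \<Rightarrow> nat" where
  "unrot k = (if k = 1 then n else if k \<in> N then k - 1 else k)"

lemma finite_N [simp]: "finite N"
  by (simp add: N_def)

lemma n_in [simp]: "n \<in> N"
  using n_ge by (simp add: N_def)

lemma rot_in [simp]: "rot k \<in> N \<longleftrightarrow> k \<in> N"
  using n_ge by (auto simp: rot_def N_def)

lemma unrot_in [simp]: "unrot k \<in> N \<longleftrightarrow> k \<in> N"
  using n_ge by (auto simp: unrot_def N_def)

lemma rot_unrot [simp]: "rot (unrot k) = k"
  using n_ge by (auto simp: rot_def unrot_def N_def)

lemma unrot_rot [simp]: "unrot (rot k) = k"
  using n_ge by (auto simp: rot_def unrot_def N_def)

lemma rot_neq [simp]: "k \<in> N \<Longrightarrow> rot k \<noteq> k" "k \<in> N \<Longrightarrow> k \<noteq> rot k"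
  using n_ge by (auto simp: rot_def N_def)

lemma unrot_neq [simp]: "k \<in> N \<Longrightarrow> unrot k \<noteq> k" "k \<in> N \<Longrightarrow> k \<noteq> unrot k"
  using n_ge by (auto simp: unrot_def N_def)

text \<open>Parity also changes at the step from \<open>n\<close> to 1 because \<open>n\<close> is
  even; the invariance of \<open>orient\<close> depends on it.\<close>

lemma even_rot: "k \<in> N \<Longrightarrow> even (rot k) \<longleftrightarrow> odd k"
  using even_n by (auto simp: rot_def N_def)

lemma rot_inject [simp]: "rot k = rot l \<longleftrightarrow> k = l"
  by (metis unrot_rot)

lemma rot_permutes: "rot permutes N"
proof (rule bij_imp_permutes)
  show "bij_betw rot N N"
    by (rule bij_betw_byWitness[where f' = unrot]) auto
  show "rot x = x" if "x \<notin> N" for x using that n_ge by (auto simp: rot_def N_def)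
qed

lemma s_eq: "k \<in> N \<Longrightarrow> s k = transpose k (rot k)"
  by (auto simp: cadj_transp_def rot_def N_def transpose_commute)

lemma s_apply: "k \<in> N \<Longrightarrow> s k x = (if x = k then rot k else if x = rot k then k else x)"
  by (simp add: s_eq transpose_def)

lemma s_permutes: "k \<in> N \<Longrightarrow> s k permutes N"
  by (simp add: s_eq permutes_swap_id)

lemma s_s [simp]: "s k \<circ> s k = id" "p \<circ> s k \<circ> s k = p"
  by (auto simp: cadj_transp_def comp_assoc)

lemma rot_s: "k \<in> N \<Longrightarrow> rot \<circ> s k = s (rot k) \<circ> rot"
  by (auto simp: fun_eq_iff s_apply)

lemma s_commute:
  "\<lbrakk>k \<in> N; l \<in> N; {k, rot k} \<inter> {l, rot l} = {}\<rbrakk> \<Longrightarrow> s k \<circ> s l = s l \<circ> s k"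
  by (auto simp: fun_eq_iff s_apply)

lemma V_eq: "V = {p. p permutes N}"
  by (simp add: perms_def N_def)

lemma finite_V: "finite V"
  by (simp add: V_eq N_def finite_permutations)

lemma comp_in_V: "\<lbrakk>p \<in> V; q permutes N\<rbrakk> \<Longrightarrow> p \<circ> q \<in> V"
  by (simp add: V_eq permutes_compose)

lemma comp_s_in_V: "\<lbrakk>p \<in> V; k \<in> N\<rbrakk> \<Longrightarrow> p \<circ> s k \<in> V"
  by (simp add: comp_in_V s_permutes)

section \<open>The position of the entry \<open>n\<close>\<close>

definition pos :: "(nat \<Rightarrow> nat) \<Rightarrow> nat" where "pos p = inv p n"

lemma pos_eq_iff: "p \<in> V \<Longrightarrow> pos p = l \<longleftrightarrow> p l = n"
  by (auto simp: pos_def V_eq permutes_inv_eq)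

lemma apply_pos: "p \<in> V \<Longrightarrow> p (pos p) = n"
  using pos_eq_iff by blast

lemma pos_in: "p \<in> V \<Longrightarrow> pos p \<in> N"
  using n_ge permutes_in_image[OF permutes_inv, of p N n] by (simp add: pos_def V_eq)

lemma pos_comp_s: "\<lbrakk>p \<in> V; k \<in> N\<rbrakk> \<Longrightarrow> pos (p \<circ> s k) = s k (pos p)"
  using apply_pos[of p] by (subst pos_eq_iff) (auto simp: comp_s_in_V s_apply)

lemma pos_comp_rot: "p \<in> V \<Longrightarrow> pos (p \<circ> rot) = unrot (pos p)"
  using apply_pos[of p] by (subst pos_eq_iff) (auto simp: comp_in_V rot_permutes)

text \<open>As \<open>n\<close> is even, removing the entry \<open>n\<close> leaves a cyclic word of odd length, whose sign is
  invariant under rotation. It is encoded by \<open>orient\<close>, and \<open>\<sigma>\<close> moves \<open>n\<close> to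
  the right or to the left according to it.\<close>

definition orient :: "(nat \<Rightarrow> nat) \<Rightarrow> bool" where
  "orient p \<longleftrightarrow> (evenperm p \<longleftrightarrow> even (pos p))"

lemma evenperm_comp_s: "\<lbrakk>p \<in> V; k \<in> N\<rbrakk> \<Longrightarrow> evenperm (p \<circ> s k) \<longleftrightarrow> \<not> evenperm p"
  using evenperm_comp[of p "s k"] permutes_imp_permutation[of N p]
  by (auto simp: V_eq s_eq evenperm_swap permutation_swap_id)

text \<open>Every swap changes the sign. If it moves \<open>n\<close>, the parity of the position of
  \<open>n\<close> changes as well, and the two changes cancel.\<close>

lemma orient_comp_s:
  "\<lbrakk>p \<in> V; k \<in> N\<rbrakk> \<Longrightarrow> orient (p \<circ> s k) \<longleftrightarrow> (if pos p \<in> {k, rot k} then orient p else \<not> orient p)"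
  by (auto simp: orient_def evenperm_comp_s pos_comp_s s_apply even_rot)

definition move :: "(nat \<Rightarrow> nat) \<Rightarrow> nat" where
  "move p = (if orient p then pos p else unrot (pos p))"

lemma move_in: "p \<in> V \<Longrightarrow> move p \<in> N"
  by (simp add: move_def pos_in)

lemma pos_in_move: "pos p \<in> {move p, rot (move p)}"
  by (simp add: move_def)

definition \<sigma> :: "(nat \<Rightarrow> nat) \<Rightarrow> nat \<Rightarrow> nat" where
  "\<sigma> p = (if p \<in> V then p \<circ> s (move p) else p)"

lemma \<sigma>_in: "p \<in> V \<Longrightarrow> \<sigma> p \<in> V"
  by (simp add: \<sigma>_def comp_s_in_V move_in)

lemma orient_\<sigma>: "p \<in> V \<Longrightarrow> orient (\<sigma> p) = orient p"
  using pos_in_move[of p] by (auto simp: \<sigma>_def orient_comp_s move_in)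

lemma pos_\<sigma>: "p \<in> V \<Longrightarrow> pos (\<sigma> p) = (if orient p then rot (pos p) else unrot (pos p))"
  using move_in[of p] by (auto simp: \<sigma>_def pos_comp_s s_apply move_def)

text \<open>The image shows the orientation, hence the direction of the step, hence the old position
  of \<open>n\<close> and the color; the swap can then be undone.\<close>

lemma inj_on_\<sigma>: "inj_on \<sigma> V"
proof (rule inj_onI)
  fix p q assume pq: "p \<in> V" "q \<in> V" "\<sigma> p = \<sigma> q"
  then have e: "orient p = orient q" by (metis orient_\<sigma>)
  have "pos (\<sigma> p) = pos (\<sigma> q)" using pq(3) by simp
  then have "pos p = pos q" using e pq(1,2) by (auto simp: pos_\<sigma> split: if_splits) (metis rot_unrot)
  then have "move p = move q" using e by (simp add: move_def)
  then show "p = q" using pq by (metis \<sigma>_def s_s(2))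
qed

lemma \<sigma>_permutes: "\<sigma> permutes V"
proof (rule inj_imp_permutes)
  show "inj_on \<sigma> V" by (rule inj_on_\<sigma>)
qed (simp_all add: finite_V \<sigma>_in, simp add: \<sigma>_def)

text \<open>Of the two swaps that move \<open>n\<close>, one is \<open>\<sigma>\<close> and the
  other its inverse. As \<open>U\<close> is finite, \<open>\<sigma>\<close> maps it onto
  itself.\<close>

lemma move_n_closed:
  assumes U: "U \<subseteq> V" "\<sigma> ` U \<subseteq> U" and p: "p \<in> U" and k: "k \<in> N" and pos: "pos p \<in> {k, rot k}"
  shows "p \<circ> s k \<in> U"
proof (cases "move p = k")
  case True
  then show ?thesis using U p by (auto simp: \<sigma>_def image_subset_iff)
next
  case False
  have pV: "p \<in> V" using U p by blast
  have q: "p \<circ> s k \<in> V" using pV k by (simp add: comp_s_in_V)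
  have "move (p \<circ> s k) = k"
    using False pos pV k
    by (auto simp: move_def orient_comp_s pos_comp_s s_apply split: if_splits)
  then have \<sigma>q: "\<sigma> (p \<circ> s k) = p" using q by (simp add: \<sigma>_def)
  have "\<sigma> ` U = U"
    using U finite_subset[OF U(1) finite_V] inj_on_subset[OF inj_on_\<sigma> U(1)] by (simp add: endo_inj_surj)
  then obtain q' where "q' \<in> U" "\<sigma> q' = p" using p by (metis imageE)
  then have "q' = p \<circ> s k" using \<sigma>q q U(1) inj_onD[OF inj_on_\<sigma>, of q' "p \<circ> s k"] by auto
  then show ?thesis using \<open>q' \<in> U\<close> by simp
qed

text \<open>As \<open>V\<close> is finite and \<open>\<sigma>\<close> is injective on it, these sets
  are the unions of orbits of \<open>\<sigma>\<close>.\<close>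

definition closed :: "(nat \<Rightarrow> nat) set \<Rightarrow> bool" where
  "closed U \<longleftrightarrow> U \<subseteq> V \<and> \<sigma> ` U \<subseteq> U"

lemma move_n: "\<lbrakk>closed U; p \<in> U; k \<in> N; pos p \<in> {k, rot k}\<rbrakk> \<Longrightarrow> p \<circ> s k \<in> U"
  using move_n_closed by (simp add: closed_def)

lemma closed_in_V: "\<lbrakk>closed U; p \<in> U\<rbrakk> \<Longrightarrow> p \<in> V"
  by (auto simp: closed_def)

lemma comp_rot_cancel:
  assumes "p \<circ> rot = q \<circ> rot"
  shows "p = q"
proof
  fix x
  show "p x = q x" using fun_cong[OF assms, of "unrot x"] by simp
qed

text \<open>Carrying \<open>n\<close> from the first position to the last shifts the other entries
  one place to the left, which rotates the whole word; all the swaps used move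
  \<open>n\<close>.\<close>

lemma rotate:
  assumes U: "closed U" and p: "p \<in> U"
  shows "p \<circ> rot \<in> U"
proof -
  \<comment> \<open>\<open>q \<circ> r m\<close> is \<open>q\<close> with its first entry moved to
    position \<open>m + 1\<close>.\<close>
  define r where "r m x = (if x \<in> {1..m} then x + 1 else if x = Suc m then 1 else x)" for m x :: nat
  have first: "q \<circ> rot \<in> U" if q: "q \<in> U" "pos q = 1" for q
  proof -
    have qV: "q \<in> V" using U q closed_in_V by blast
    have "q \<circ> r m \<in> U" if "m < n" for m
      using that
    proof (induction m)
      case 0
      have "r 0 = id" by (auto simp: r_def)
      then show ?case using q by simp
    next
      case (Suc m)
      have m: "Suc m \<in> N" "rot (Suc m) = m + 2" using Suc.prems by (auto simp: N_def rot_def)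
      have IH: "q \<circ> r m \<in> U" using Suc.IH Suc.prems Suc_lessD by blast
      have "q 1 = n" using apply_pos[OF qV] q by simp
      then have "pos (q \<circ> r m) = Suc m"
        by (subst pos_eq_iff) (use IH U closed_in_V in \<open>auto simp: r_def\<close>)
      then have "q \<circ> r m \<circ> s (Suc m) \<in> U" using move_n[OF U IH] m by simp
      moreover have "r (Suc m) = r m \<circ> s (Suc m)"
        using m by (auto simp: fun_eq_iff s_apply r_def)
      ultimately show ?case by (simp only: comp_assoc)
    qed
    then have "q \<circ> r (n - 1) \<in> U" using n_ge by simp
    moreover have "r (n - 1) = rot" using n_ge by (auto simp: r_def rot_def N_def fun_eq_iff)
    ultimately show ?thesis by simp
  qed
  have "q \<circ> rot \<in> U" if "q \<in> U" "pos q = Suc l" for q l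
    using that
  proof (induction l arbitrary: q)
    case 0
    show ?case by (rule first[OF 0(1)]) (use 0(2) in simp)
  next
    case (Suc l)
    have qV: "q \<in> V" using U Suc closed_in_V by blast
    \<comment> \<open>Take \<open>n\<close> one place to the left, rotate, and undo the swap in its
      rotated form.\<close>
    define k where "k = Suc l"
    have k: "k \<in> N" "rot k = pos q" "pos q \<noteq> k"
      using pos_in[OF qV] Suc.prems(2) by (auto simp: k_def N_def rot_def)
    have q1: "q \<circ> s k \<in> U" using move_n[OF U Suc.prems(1) k(1)] k by simp
    have pos1: "pos (q \<circ> s k) = k" using qV k by (simp add: pos_comp_s s_apply)
    have q2: "q \<circ> s k \<circ> rot \<in> U" using Suc.IH[OF q1] pos1 unfolding k_def by blast
    have eq: "q \<circ> s k \<circ> rot = q \<circ> rot \<circ> s (unrot k)" using rot_s[of "unrot k"] k by (simp add: comp_assoc)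
    have "pos (q \<circ> s k \<circ> rot) = unrot k" using pos_comp_rot[of "q \<circ> s k"] pos1 U q1 closed_in_V by simp
    then have "q \<circ> s k \<circ> rot \<circ> s (unrot k) \<in> U" using move_n[OF U q2, of "unrot k"] k by simp
    moreover have "q \<circ> s k \<circ> rot \<circ> s (unrot k) = q \<circ> rot" unfolding eq by (rule s_s(2))
    ultimately show ?case by (rule back_subst[of "\<lambda>r. r \<in> U"])
  qed
  moreover obtain l where "pos p = Suc l"
    using pos_in[of p] U p closed_in_V by (cases "pos p") (auto simp: N_def)
  ultimately show ?thesis using p by blast
qed

lemma unrotate:
  assumes U: "closed U" and p: "p \<in> U"
  obtains q where "q \<in> U" "p = q \<circ> rot"
proof -
  have "inj_on (\<lambda>p. p \<circ> rot) U"
    by (rule inj_onI) (rule comp_rot_cancel)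
  moreover have "finite U" using U finite_V finite_subset by (auto simp: closed_def)
  moreover have "(\<lambda>p. p \<circ> rot) ` U \<subseteq> U" using rotate[OF U] by blast
  ultimately have "(\<lambda>p. p \<circ> rot) ` U = U" by (intro endo_inj_surj)
  then have "p \<in> (\<lambda>p. p \<circ> rot) ` U" using p by (simp only:)
  then show thesis by (elim imageE) (rule that)
qed

lemma rotateD:
  assumes U: "closed U" and p: "p \<circ> rot \<in> U"
  shows "p \<in> U"
proof -
  obtain q where q: "q \<in> U" "p \<circ> rot = q \<circ> rot" using unrotate[OF U p] by blast
  then show ?thesis using comp_rot_cancel by metis
qed

text \<open>The merging needs the contrapositive: while a nonempty union of orbits is not all of
  \<open>V\<close>, some edge of the prescribed color \<open>i\<close> in it starts at a vertex
  whose \<open>j\<close>-neighbor lies outside. One pair of colors suffices, because rotations and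
  moves of \<open>n\<close> spread closure under \<open>s j\<close> to all colors and all positions
  of \<open>n\<close>.\<close>

lemma closed_eq_V:
  assumes U: "closed U" "U \<noteq> {}" and i: "i \<in> N" and j: "j \<in> N"
    and disj: "{i, rot i} \<inter> {j, rot j} = {}"
    and step: "\<And>p. p \<in> U \<Longrightarrow> move p = i \<Longrightarrow> p \<circ> s j \<in> U"
  shows "U = V"
proof -
  note inV = closed_in_V[OF U(1)]
  define Q where "Q k l \<longleftrightarrow> (\<forall>p\<in>U. pos p = l \<longrightarrow> p \<circ> s k \<in> U)" for k l
  \<comment> \<open>In the 4-cycle with colors \<open>k, l, k, l\<close> the \<open>l\<close>-edges
    move \<open>n\<close> and so stay in \<open>U\<close>; hence one \<open>k\<close>-edge in
    \<open>U\<close> yields the other.\<close>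
  have swap: "p \<circ> s k \<in> U"
    if k: "k \<in> N" and l: "l \<in> N" and kl: "{k, rot k} \<inter> {l, rot l} = {}" and p: "p \<in> U"
      and pos: "pos p \<in> {l, rot l}" and q: "p \<circ> s l \<circ> s k \<in> U" for p k l
  proof -
    have "p \<circ> s l \<circ> s k = p \<circ> s k \<circ> s l"
      using s_commute[OF k l kl] by (simp add: comp_assoc)
    then have "p \<circ> s k \<circ> s l \<in> U" using q by simp
    moreover have "pos (p \<circ> s k \<circ> s l) \<in> {l, rot l}"
      using inV[OF p] k l kl pos by (auto simp: pos_comp_s comp_s_in_V s_apply)
    ultimately have "p \<circ> s k \<circ> s l \<circ> s l \<in> U" using move_n[OF U(1)] l by blast
    then show ?thesis by simp
  qed
  have slide: "Q k x" if "Q k (s l x)" "k \<in> N" "l \<in> N" "{k, rot k} \<inter> {l, rot l} = {}" "x \<in> {l, rot l}" for k l x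
    unfolding Q_def
  proof (intro ballI impI)
    fix p assume p: "p \<in> U" "pos p = x"
    have "p \<circ> s l \<in> U" using move_n[OF U(1) p(1), of l] that p by simp
    moreover have "pos (p \<circ> s l) = s l x" using inV p that by (simp add: pos_comp_s)
    ultimately have "p \<circ> s l \<circ> s k \<in> U" using that(1) by (simp add: Q_def)
    then show "p \<circ> s k \<in> U" using swap[OF that(2,3,4) p(1)] p that(5) by simp
  qed
  have "Q j i"
    unfolding Q_def
  proof (intro ballI impI)
    fix p assume p: "p \<in> U" "pos p = i"
    show "p \<circ> s j \<in> U"
    proof (cases "orient p")
      case True
      then show ?thesis using step p by (simp add: move_def)
    next
      \<comment> \<open>Here \<open>n\<close> leaves position \<open>i\<close> to the left. At the
        \<open>i\<close>-neighbor of \<open>p\<close> it leaves along color \<open>i\<close>, so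
        \<open>step\<close> applies there.\<close>
      case False
      have "p \<circ> s i \<in> U" using move_n[OF U(1) p(1) i] p by simp
      moreover have "move (p \<circ> s i) = i"
        using False inV[OF p(1)] i p(2) by (simp add: move_def orient_comp_s pos_comp_s s_apply)
      ultimately have "p \<circ> s i \<circ> s j \<in> U" using step by blast
      then show ?thesis using swap[OF j i _ p(1)] p(2) disj by auto
    qed
  qed
  \<comment> \<open>A rotation takes both the color and the position of \<open>n\<close> one place
    back, until the color is 1.\<close>
  have down: "\<exists>l'\<in>{3..n}. Q 1 l'" if "Q (Suc m) l" "Suc m \<in> N" "l \<in> N" "l \<notin> {Suc m, rot (Suc m)}" for m l
    using that
  proof (induction m arbitrary: l)
    case 0
    then show ?case using n_ge by (auto simp: rot_def N_def intro!: bexI[of _ l])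
  next
    case (Suc m)
    have cm: "rot (Suc m) = Suc (Suc m)" "Suc m \<in> N" using Suc.prems(2) by (auto simp: rot_def N_def)
    have "Q (Suc m) (unrot l)"
      unfolding Q_def
    proof (intro ballI impI)
      fix p assume p: "p \<in> U" "pos p = unrot l"
      obtain q where q: "q \<in> U" "p = q \<circ> rot" using unrotate[OF U(1) p(1)] by blast
      have "pos q = l" using p q inV by (metis rot_unrot pos_comp_rot)
      then have "q \<circ> s (rot (Suc m)) \<in> U" using Suc.prems(1) q(1) cm by (simp add: Q_def)
      then have "q \<circ> s (rot (Suc m)) \<circ> rot \<in> U" by (rule rotate[OF U(1)])
      then show "p \<circ> s (Suc m) \<in> U" using rot_s[OF cm(2)] q(2) by (simp add: comp_assoc)
    qed
    then show ?case
      using Suc.IH[of "unrot l"] Suc.prems cm by (metis unrot_in rot_unrot insert_iff singletonD insertCI)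
  qed
  obtain m where m: "j = Suc m" using j by (cases j) (auto simp: N_def)
  have "\<exists>l'\<in>{3..n}. Q 1 l'"
    by (rule down[of m i]) (use \<open>Q j i\<close> i j disj m in auto)
  then obtain l0 where l0: "l0 \<in> {3..n}" "Q 1 l0" by blast
  \<comment> \<open>Positions 3 to \<open>n\<close> form a path along which \<open>n\<close> can
    walk without touching positions 1 and 2.\<close>
  have slide1: "Q 1 (Suc l) \<longleftrightarrow> Q 1 l" if "l \<in> {3..<n}" for l
  proof -
    have l: "l \<in> N" "1 \<in> N" "rot l = Suc l" "rot 1 = 2" using that by (auto simp: N_def rot_def)
    have d: "{1, rot 1} \<inter> {l, rot l} = {}" using l that by auto
    show ?thesis
      using slide[OF _ l(2,1) d, of "rot l"] slide[OF _ l(2,1) d, of l] l by (auto simp: s_apply)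
  qed
  have "Q 1 l = Q 1 3" if "l \<in> {3..n}" for l
    using that
  proof (induction l)
    case (Suc l)
    then show ?case using slide1[of l] by (cases "l = 2") auto
  qed auto
  then have Q1: "Q 1 l" if "l \<in> {3..n}" for l using l0 that by blast
  have s1: "p \<circ> s 1 \<in> U" if p: "p \<in> U" for p
  proof (cases "pos p \<in> {3..n}")
    case True
    then show ?thesis using Q1 p by (auto simp: Q_def)
  next
    case False
    moreover have "1 \<in> N" "rot 1 = 2" using n_ge by (auto simp: N_def rot_def)
    moreover have "pos p \<in> N" using inV p pos_in by blast
    ultimately show ?thesis by (intro move_n[OF U(1) p]) (auto simp: N_def)
  qed
  \<comment> \<open>Rotating, swapping and rotating back carries closure under color 1 to every
    color.\<close>
  have sk: "p \<circ> s (Suc m) \<in> U" if "Suc m \<in> N" "p \<in> U" for p m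
    using that
  proof (induction m arbitrary: p)
    case 0
    show ?case using s1[OF 0(2)] unfolding One_nat_def .
  next
    case (Suc m)
    have cm: "rot (Suc m) = Suc (Suc m)" "Suc m \<in> N" using Suc.prems(1) by (auto simp: rot_def N_def)
    have "p \<circ> rot \<circ> s (Suc m) \<in> U" using Suc cm rotate[OF U(1)] by blast
    then have "p \<circ> s (rot (Suc m)) \<circ> rot \<in> U" using rot_s[OF cm(2)] by (simp add: comp_assoc)
    then show ?case unfolding cm(1) by (rule rotateD[OF U(1)])
  qed
  have adj: "p \<circ> transpose a (Suc a) \<in> U" if "a \<in> {1..<n}" "p \<in> U" for p a
    using sk[of "a - 1" p] that by (cases a) (auto simp: N_def s_eq rot_def)
  have trans: "p \<circ> transpose a b \<in> U" if "a \<in> {1..n}" "b \<in> {1..n}" "a < b" "p \<in> U" for p a b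
    using that
  proof (induction b arbitrary: p)
    case (Suc b)
    show ?case
    proof (cases "a = b")
      case True
      have "a \<in> {1..<n}" using Suc.prems by simp
      then show ?thesis using adj[OF _ Suc.prems(4)] True by metis
    next
      case False
      have "p \<circ> transpose b (Suc b) \<circ> transpose a b \<circ> transpose b (Suc b) \<in> U"
        using Suc False adj by (intro adj Suc.IH) auto
      moreover have "transpose b (Suc b) \<circ> transpose a b \<circ> transpose b (Suc b) = transpose a (Suc b)"
        using Suc.prems False by (auto simp: fun_eq_iff transpose_def)
      ultimately show ?thesis by (simp only: comp_assoc)
    qed
  qed auto
  obtain p where p: "p \<in> U" using U by blast
  have "V \<subseteq> U"
  proof
    fix q assume q: "q \<in> V"
    have pp: "p permutes {1..n}" "q permutes {1..n}" using inV[OF p] q by (auto simp: perms_def)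
    have "inv p \<circ> q permutes {1..n}" using pp by (simp add: permutes_inv permutes_compose)
    from finite_atLeastAtMost this have "p \<circ> (inv p \<circ> q) \<in> U"
    proof (induction rule: permutes_rev_induct)
      case id
      then show ?case using p by simp
    next
      case (swap a b r)
      consider "a < b" | "b < a" using swap.hyps by linarith
      then have "p \<circ> r \<circ> transpose a b \<in> U"
      proof cases
        case 1
        then show ?thesis by (rule trans[OF swap(1,2) _ swap.IH])
      next
        case 2
        then show ?thesis
          by (subst transpose_commute) (rule trans[OF swap(2,1) _ swap.IH])
      qed
      then show ?case by (simp only: comp_assoc)
    qed
    moreover have "p \<circ> (inv p \<circ> q) = q"
      using pp(1) by (simp add: fun_eq_iff permutes_inverses)
    ultimately show "q \<in> U" by (simp only:)
  qed
  then show ?thesis using U(1) by (simp add: closed_def subset_antisym)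
qed

text \<open>Reversing the edges of color \<open>a\<close> that take \<open>n\<close> to the left
  matches the permutations leaving along \<open>a\<close> with those having \<open>n\<close> at
  position \<open>a\<close>, of which there are \<open>(n - 1)!\<close>.\<close>

lemma card_move:
  assumes a: "a \<in> N"
  shows "(\<Sum>p\<in>V. of_bool (move p = a)) = (fact (n - 1) :: nat)"
proof -
  let ?h = "\<lambda>p. if orient p then p else p \<circ> s a"
  have e: "orient (p \<circ> s a) = orient p" if "p \<in> V" "pos p \<in> {a, rot a}" for p
    using that a by (simp add: orient_comp_s)
  have pd: "pos p \<in> {a, rot a}" if "move p = a" for p using that pos_in_move by blast
  have bij: "bij_betw ?h {p \<in> V. pos p = a} {p \<in> V. move p = a}"
  proof (rule bij_betw_byWitness[where f' = ?h])
    have h: "?h (?h p) = p" if "p \<in> V" "pos p \<in> {a, rot a}" for p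
      using e[OF that] by simp
    show "\<forall>p\<in>{p \<in> V. pos p = a}. ?h (?h p) = p" by (intro ballI h) auto
    show "\<forall>p\<in>{p \<in> V. move p = a}. ?h (?h p) = p" by (intro ballI h) (use pd in auto)
    have "?h p \<in> V \<and> move (?h p) = a" if "p \<in> V" "pos p = a" for p
      using that a e[of p] by (simp add: move_def comp_s_in_V pos_comp_s s_apply)
    then show "?h ` {p \<in> V. pos p = a} \<subseteq> {p \<in> V. move p = a}" by blast
    have "?h p \<in> V \<and> pos (?h p) = a" if p: "p \<in> V" "move p = a" for p
    proof -
      have "pos p = (if orient p then a else rot a)" using p(2) by (auto simp: move_def)
      then show ?thesis using p(1) a by (simp add: comp_s_in_V pos_comp_s s_apply)
    qed
    then show "?h ` {p \<in> V. move p = a} \<subseteq> {p \<in> V. pos p = a}" by blast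
  qed
  have tt: "q \<circ> transpose a n \<circ> transpose a n = q" for q :: "nat \<Rightarrow> nat"
    by (simp add: fun_eq_iff)
  have bij': "bij_betw (\<lambda>p. p \<circ> transpose a n) {p. p permutes {1..n - 1}} {p \<in> V. pos p = a}"
  proof (rule bij_betw_byWitness[where f' = "\<lambda>p. p \<circ> transpose a n"])
    have V: "q \<in> V" if "q permutes {1..n - 1}" for q
      using permutes_subset[OF that] by (auto simp: perms_def)
    have t: "transpose a n permutes N" using a by (simp add: permutes_swap_id)
    show "(\<lambda>p. p \<circ> transpose a n) ` {p. p permutes {1..n - 1}} \<subseteq> {p \<in> V. pos p = a}"
    proof clarify
      fix q assume q: "q permutes {1..n - 1}"
      have "q \<circ> transpose a n \<in> V" using comp_in_V[OF V[OF q] t] .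
      moreover have "q n = n" using permutes_not_in[OF q] n_ge by auto
      ultimately show "q \<circ> transpose a n \<in> V \<and> pos (q \<circ> transpose a n) = a"
        by (simp add: pos_eq_iff)
    qed
    show "(\<lambda>p. p \<circ> transpose a n) ` {p \<in> V. pos p = a} \<subseteq> {p. p permutes {1..n - 1}}"
    proof (intro image_subsetI CollectI, elim CollectE conjE)
      fix q assume q: "q \<in> V" "pos q = a"
      have "q \<circ> transpose a n permutes {1..n}"
        using comp_in_V[OF q(1) t] by (simp add: perms_def)
      then show "q \<circ> transpose a n permutes {1..n - 1}"
      proof (rule permutes_superset)
        fix x assume "x \<in> {1..n} - {1..n - 1}"
        then have "x = n" by auto
        moreover have "q a = n" using apply_pos[OF q(1)] by (simp only: q(2))
        ultimately show "(q \<circ> transpose a n) x = x" by (simp only: comp_apply transpose_apply_second)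
      qed
    qed
  qed (simp_all only: tt, simp_all)
  have "card {p \<in> V. move p = a} = card {p \<in> V. pos p = a}"
    by (rule bij_betw_same_card[OF bij, symmetric])
  also have "\<dots> = card {p. p permutes {1..n - 1}}"
    by (rule bij_betw_same_card[OF bij', symmetric])
  also have "\<dots> = fact (n - 1)" by (rule card_permutations) simp_all
  finally show ?thesis by (simp add: finite_V Int_def)
qed

section \<open>Merging the cycles\<close>

definition cyc :: "(nat \<Rightarrow> nat) \<Rightarrow> bool" where
  "cyc p = cyc3 (inv p 1) (inv p 2) (inv p 3)"

lemma inv_in: "\<lbrakk>p \<in> V; x \<in> N\<rbrakk> \<Longrightarrow> inv p x \<in> N"
  by (metis V_eq mem_Collect_eq permutes_in_image permutes_inv)

lemma inv_comp_s: "\<lbrakk>p \<in> V; k \<in> N\<rbrakk> \<Longrightarrow> inv (p \<circ> s k) x = s k (inv p x)"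
  using o_inv_distrib[of p "s k"] by (auto simp: V_eq permutes_bij s_permutes s_eq inv_swap_id)

text \<open>A step swaps \<open>n\<close> with one other entry, and \<open>n\<close> is none of 1,
  2, 3, so their cyclic order is kept.\<close>

lemma cyc_\<sigma>:
  assumes p: "p \<in> V"
  shows "cyc (\<sigma> p) = cyc p"
proof -
  have dist: "inv p x \<noteq> inv p y" if "x \<noteq> y" for x y
    using p that by (metis V_eq mem_Collect_eq permutes_inv_eq)
  have ne: "inv p 1 \<noteq> inv p 2" "inv p 2 \<noteq> inv p 3" "inv p 1 \<noteq> inv p 3"
    "pos p \<notin> {inv p 1, inv p 2, inv p 3}"
    unfolding pos_def using n_ge by (simp_all add: dist)
  have "1 \<in> N" "2 \<in> N" "3 \<in> N" using n_ge by (auto simp: N_def)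
  then have N: "{inv p 1, inv p 2, inv p 3} \<subseteq> {1..n}" using inv_in[OF p] by (auto simp: N_def)
  have k: "move p \<in> N" by (rule move_in[OF p])
  have "cyc3 (s (move p) (inv p 1)) (s (move p) (inv p 2)) (s (move p) (inv p 3)) = cyc p"
  proof (cases "move p = n")
    case True
    then have "pos p \<in> {1, n}" using pos_in_move[of p] by (auto simp: rot_def)
    then show ?thesis
      using cyc3_transpose_ends[OF ne(1-3) _ ne(4) N] True by (simp add: cyc_def cadj_transp_def)
  next
    case False
    then have "pos p \<in> {move p, Suc (move p)}" using pos_in_move[of p] k by (auto simp: rot_def N_def)
    then show ?thesis
      using cyc3_transpose_Suc[OF _ ne(4)] False by (simp add: cyc_def cadj_transp_def)
  qed
  then show ?thesis using p k by (simp add: cyc_def \<sigma>_def inv_comp_s)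
qed

lemma orbit_invariant:
  assumes "\<And>p. p \<in> V \<Longrightarrow> h (\<sigma> p) = h p" "p \<in> V" "q \<in> orbit \<sigma> p"
  shows "h q = h p"
proof -
  have "q \<in> V \<and> h q = h p"
    using assms(3) by induction (use assms(1,2) \<sigma>_in in auto)
  then show ?thesis ..
qed

text \<open>At least two merges are needed: a single one could not be balanced. The two invariants
  \<open>orient\<close> and \<open>cyc\<close> already separate three orbits.\<close>

lemma three_orbits: "3 \<le> card (orbit \<sigma> ` V)"
proof -
  \<comment> \<open>\<open>?p\<close> changes both the sign and the cyclic order of 1, 2, 3, whereas
    \<open>?q\<close> changes only the sign. Both fix \<open>n\<close>.\<close>
  let ?p = "transpose 1 2 :: nat \<Rightarrow> nat" and ?q = "transpose 4 5 :: nat \<Rightarrow> nat"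
  have V: "id \<in> V" "?p \<in> V" "?q \<in> V"
    using n_ge by (auto simp: V_eq N_def permutes_id intro!: permutes_swap_id)
  have h: "orient id" "cyc id" "\<not> orient ?p" "\<not> cyc ?p" "\<not> orient ?q" "cyc ?q"
    using even_n n_ge
    by (auto simp: orient_def cyc_def cyc3_def pos_def evenperm_swap inv_swap_id transpose_def)
  have "orbit \<sigma> a \<noteq> orbit \<sigma> b" if "a \<in> V" "b \<in> V" "orient a \<noteq> orient b \<or> cyc a \<noteq> cyc b" for a b
  proof
    assume "orbit \<sigma> a = orbit \<sigma> b"
    moreover have "a \<in> orbit \<sigma> a"
      using \<sigma>_permutes finite_V by (metis permutation_permutes permutation_self_in_orbit)
    ultimately have "a \<in> orbit \<sigma> b" by simp
    then show False
      using that(3) orbit_invariant[of orient, OF orient_\<sigma> that(2)]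
        orbit_invariant[of cyc, OF cyc_\<sigma> that(2)] by blast
  qed
  then have "card {orbit \<sigma> id, orbit \<sigma> ?p, orbit \<sigma> ?q} = 3" using V h by simp
  moreover have "{orbit \<sigma> id, orbit \<sigma> ?p, orbit \<sigma> ?q} \<subseteq> orbit \<sigma> ` V" using V by blast
  ultimately show ?thesis using finite_V by (metis card_mono finite_imageI)
qed

text \<open>On 1 to 5 this is the permutation \<open>(1 3 5)(2 4)\<close>, which takes each color to
  a disjoint one. These colors touch positions 1 to 6, hence the bound on \<open>n\<close>.\<close>

definition exch :: "nat \<Rightarrow> nat" where
  "exch i = (if i = 1 then 3 else if i = 3 then 5 else if i = 5 then 1 else if i = 2 then 4 else 2)"

lemma exch:
  assumes "i \<in> {1..5}"
  shows "i \<in> N" "exch i \<in> N" "{i, rot i} \<inter> {exch i, rot (exch i)} = {}"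
proof -
  have "i = 1 \<or> i = 2 \<or> i = 3 \<or> i = 4 \<or> i = 5" using assms by auto
  then show "i \<in> N" "exch i \<in> N" "{i, rot i} \<inter> {exch i, rot (exch i)} = {}"
    using n_ge by (auto simp: exch_def N_def rot_def)
qed

lemma permutation_\<sigma>: "permutation \<sigma>"
  using \<sigma>_permutes finite_V permutation_permutes by blast

lemma in_orbit_\<sigma>: "p \<in> orbit \<sigma> p"
  by (rule permutation_self_in_orbit[OF permutation_\<sigma>])

text \<open>In the conjunct on \<open>col p \<noteq> move p\<close>: an edge is given up only if the 4-cycle through it stays
  inside the merged part. Hence every edge that can be used to reach a new orbit is still present.\<close>

definition glued ::
  "(nat \<Rightarrow> nat) \<Rightarrow> nat \<Rightarrow> (nat \<Rightarrow> nat) set set \<Rightarrow> ((nat \<Rightarrow> nat) \<Rightarrow> nat \<Rightarrow> nat) \<Rightarrow>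
    ((nat \<Rightarrow> nat) \<Rightarrow> nat) \<Rightarrow> bool"
  where
  "glued \<tau> k X f col \<longleftrightarrow>
    X \<subseteq> orbit \<sigma> ` V \<and> card X = Suc k \<and> cyclic_on f (\<Union>X) \<and>
    (\<forall>p\<in>V. col p \<in> N \<and> f p = p \<circ> s (col p)) \<and>
    (\<forall>p\<in>V. col p \<noteq> move p \<longrightarrow> p \<in> \<Union>X \<and> p \<circ> s (exch (move p)) \<in> \<Union>X) \<and>
    (\<forall>a\<in>N. (\<Sum>p\<in>V. of_bool (col p = a)) + 2 * (\<Sum>t<k. of_bool (\<tau> t = a))
      = fact (n - 1) + 2 * (\<Sum>t<k. of_bool (exch (\<tau> t) = a) :: nat))"

text \<open>The color exchanged in merge \<open>t\<close> can be prescribed as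
  \<open>\<tau> t\<close>, since \<open>closed_eq_V\<close> finds an edge for each pair
  \<open>i\<close>, \<open>exch i\<close>. A merge trades two edges of color \<open>i\<close> for
  two of color \<open>exch i\<close>, whence the factors 2 in \<open>glued\<close>.\<close>

lemma glue_orbits:
  assumes \<tau>: "\<And>t. \<tau> t \<in> {1..5}" and k: "k < card (orbit \<sigma> ` V)"
  shows "\<exists>X f col. glued \<tau> k X f col"
  using k
proof (induction k)
  case 0
  have "id \<in> V" by (simp add: V_eq permutes_id)
  moreover have "\<sigma> p = p \<circ> s (move p)" if "p \<in> V" for p using that by (simp only: \<sigma>_def if_True)
  ultimately have "glued \<tau> 0 {orbit \<sigma> id} \<sigma> move"
    unfolding glued_def
    by (simp add: move_in card_move cyclic_on_orbit'[OF permutation_\<sigma>] del: sum_of_bool_eq)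
  then show ?case by blast
next
  case (Suc k)
  then obtain X f col where state: "glued \<tau> k X f col" using Suc_lessD by blast
  have X: "X \<subseteq> orbit \<sigma> ` V" "card X = Suc k"
    and cyc: "cyclic_on f (\<Union>X)" and col: "\<forall>p\<in>V. col p \<in> N \<and> f p = p \<circ> s (col p)"
    and used: "\<forall>p\<in>V. col p \<noteq> move p \<longrightarrow> p \<in> \<Union>X \<and> p \<circ> s (exch (move p)) \<in> \<Union>X"
    and bal: "\<forall>a\<in>N. (\<Sum>p\<in>V. of_bool (col p = a)) + 2 * (\<Sum>t<k. of_bool (\<tau> t = a))
      = fact (n - 1) + 2 * (\<Sum>t<k. of_bool (exch (\<tau> t) = a) :: nat)"
    using state unfolding glued_def by - (elim conjE, assumption)+
  let ?U = "\<Union>X"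
  define i where "i = \<tau> k"
  define j where "j = exch i"
  have ij: "i \<in> N" "j \<in> N" "{i, rot i} \<inter> {j, rot j} = {}" using exch[OF \<tau>] by (auto simp: i_def j_def)
  have orb: "orbit \<sigma> y = orbit \<sigma> x" if "y \<in> orbit \<sigma> x" for x y
    using that cyclic_on_orbit'[OF permutation_\<sigma>] orbit_cyclic_eq3 by metis
  have inX: "orbit \<sigma> p \<in> X" if "p \<in> ?U" for p using that X(1) orb by auto
  have "?U \<subseteq> V" using X(1) permutes_orbit_subset[OF \<sigma>_permutes] by blast
  moreover have "\<sigma> ` ?U \<subseteq> ?U" using UnionI[OF inX orbit.base] by blast
  ultimately have U: "closed ?U" by (simp add: closed_def)
  have "?U \<noteq> {}" using cyc by (auto simp: cyclic_on_def)
  moreover have "?U \<noteq> V"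
  proof
    assume "?U = V"
    then have "orbit \<sigma> ` V \<subseteq> X" using inX by (intro image_subsetI) (simp only:)
    then have "X = orbit \<sigma> ` V" using X(1) by (rule subset_antisym[rotated])
    then show False using X(2) Suc.prems by (simp only: less_irrefl)
  qed
  ultimately obtain v where v: "v \<in> ?U" "move v = i" "v \<circ> s j \<notin> ?U"
    using closed_eq_V[OF U _ ij] by blast
  have vV: "v \<in> V" using U v closed_in_V by blast
  \<comment> \<open>\<open>v\<close>, \<open>v \<circ> s i\<close>, \<open>w\<close>,
    \<open>y\<close> is the 4-cycle with colors \<open>i, j, i, j\<close>; its first two vertices
    lie in \<open>?U\<close>, the other two in the new orbit.\<close>
  define y where "y = v \<circ> s j"
  define w where "w = v \<circ> s i \<circ> s j"
  have yV: "y \<in> V" and wV: "w \<in> V" using vV ij by (auto simp: y_def w_def comp_s_in_V)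
  have comm: "v \<circ> s i \<circ> s j = v \<circ> s j \<circ> s i" using s_commute[OF ij] by (simp add: comp_assoc)
  have posv: "pos v \<in> {i, rot i}" using pos_in_move v by blast
  \<comment> \<open>The \<open>j\<close>-swap does not involve \<open>n\<close>, so it reverses the
    orientation: the \<open>i\<close>-edge of the new orbit runs from \<open>w\<close> to
    \<open>y\<close>, against the one from \<open>v\<close>. Thus the \<open>j\<close>-edges can be
    directed from \<open>v\<close> to \<open>y\<close> and from \<open>w\<close> to
    \<open>v \<circ> s i\<close>.\<close>
  have dw: "move w = i"
  proof -
    have vi: "v \<circ> s i \<in> V" using vV ij by (simp add: comp_s_in_V)
    have p1: "pos (v \<circ> s i) \<in> {i, rot i}" "pos (v \<circ> s i) \<notin> {j, rot j}"
      using posv ij by (auto simp: pos_comp_s[OF vV ij(1)] s_apply)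
    have p2: "pos w = pos (v \<circ> s i)"
      using p1(2) ij by (simp add: w_def pos_comp_s[OF vi ij(2)] s_apply)
    have e: "orient w \<longleftrightarrow> \<not> orient v"
      using p1(2) posv ij by (simp add: w_def orient_comp_s[OF vi] orient_comp_s[OF vV])
    have "pos v = (if orient v then i else rot i)" using v(2) by (auto simp: move_def)
    then have "pos (v \<circ> s i) = (if orient v then rot i else i)"
      using ij by (simp add: pos_comp_s[OF vV ij(1)] s_apply)
    then show ?thesis using e by (simp add: move_def p2)
  qed
  have \<sigma>w: "\<sigma> w = y" using wV dw by (simp add: \<sigma>_def w_def y_def comm)
  have \<sigma>v: "\<sigma> v = v \<circ> s i" using vV v(2) by (simp add: \<sigma>_def)
  define B where "B = orbit \<sigma> y"
  have BU: "?U \<inter> B = {}"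
  proof (rule ccontr)
    assume "?U \<inter> B \<noteq> {}"
    then obtain x where x: "x \<in> ?U" "x \<in> B" by blast
    have "orbit \<sigma> x = B" unfolding B_def by (rule orb) (use x(2) B_def in simp)
    then have "B \<in> X" using inX[OF x(1)] by (simp only:)
    then show False using v(3) in_orbit_\<sigma>[of y] unfolding B_def y_def by (metis UnionI)
  qed
  have yw: "y \<in> orbit \<sigma> w" using orbit.base[of \<sigma> w] unfolding \<sigma>w .
  have wB: "w \<in> B" unfolding B_def orb[OF yw] by (rule in_orbit_\<sigma>)
  have yB: "y \<in> B" by (simp add: B_def in_orbit_\<sigma>)
  have BV: "B \<subseteq> V" using permutes_orbit_subset[OF \<sigma>_permutes yV] by (simp add: B_def)
  have wy: "w \<noteq> v" using wB v(1) BU by blast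
  \<comment> \<open>Had the edge at \<open>v\<close> been exchanged before, \<open>used\<close>
    would put \<open>v \<circ> s j\<close> into \<open>?U\<close>.\<close>
  have colv: "col v = i" using used vV v by (metis j_def)
  \<comment> \<open>All exchanged edges start in \<open>?U\<close>, so the new orbit is still
    untouched.\<close>
  have colB: "col p = move p" if "p \<in> B" for p using used that BV BU by blast
  have fB: "f p = \<sigma> p" if "p \<in> B" for p using colB[OF that] col that BV by (auto simp: \<sigma>_def)
  have cycB: "cyclic_on f B"
    using cyclic_cong[of B f \<sigma>] fB cyclic_on_orbit'[OF permutation_\<sigma>] by (auto simp: B_def)
  \<comment> \<open>The new successors are \<open>g v = y = v \<circ> s j\<close> and
    \<open>g w = v \<circ> s i = w \<circ> s j\<close>, both along color \<open>j\<close>.\<close>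
  define g where "g = f \<circ> transpose v w"
  define col' where "col' = col(v := j, w := j)"
  have fv: "f v = v \<circ> s i" using col vV colv by simp
  have fw: "f w = y" using fB wB \<sigma>w by simp
  have cyc': "cyclic_on g (\<Union>(insert B X))"
    unfolding g_def using cyclic_on_merge[OF cyc cycB v(1) wB BU] by (simp add: Un_commute)
  have col_g: "\<forall>p\<in>V. col' p \<in> N \<and> g p = p \<circ> s (col' p)"
    using col ij fv fw wy by (auto simp: col'_def g_def transpose_def y_def w_def)
  have "v \<circ> s i \<in> ?U"
    using UnionI[OF inX[OF v(1)] orbit.base] unfolding \<sigma>v .
  then have wj: "w \<circ> s j \<in> ?U" by (simp only: w_def s_s)
  have yvj: "v \<circ> s j \<in> B" using yB unfolding y_def .
  have used': "\<forall>p\<in>V. col' p \<noteq> move p \<longrightarrow>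
      p \<in> \<Union>(insert B X) \<and> p \<circ> s (exch (move p)) \<in> \<Union>(insert B X)"
  proof (intro ballI impI)
    fix p assume p: "p \<in> V" "col' p \<noteq> move p"
    consider "p = w" | "p = v" | "p \<noteq> w" "p \<noteq> v" by blast
    then show "p \<in> \<Union>(insert B X) \<and> p \<circ> s (exch (move p)) \<in> \<Union>(insert B X)"
    proof cases
      case 1
      then show ?thesis using wj wB unfolding 1 dw j_def Union_insert by blast
    next
      case 2
      then show ?thesis using yvj v(1) unfolding 2 v(2) j_def Union_insert by blast
    next
      case 3
      then have "col p \<noteq> move p" using p(2) by (simp add: col'_def)
      then show ?thesis using used p(1) unfolding Union_insert by blast
    qed
  qed
  have "finite X" using X(2) by (metis Suc_neq_Zero card.infinite)
  moreover have "B \<notin> X" using yB BU by blast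
  ultimately have card': "card (insert B X) = Suc (Suc k)" using X(2) by simp
  have colw: "col w = i" using colB[OF wB] dw by simp
  have bal': "\<forall>a\<in>N. (\<Sum>p\<in>V. of_bool (col' p = a)) + 2 * (\<Sum>t<Suc k. of_bool (\<tau> t = a))
      = fact (n - 1) + 2 * (\<Sum>t<Suc k. of_bool (exch (\<tau> t) = a) :: nat)"
  proof
    fix a assume a: "a \<in> N"
    have "(\<Sum>p\<in>V. of_bool (col' p = a)) + of_bool ((col(v := j)) w = a)
        = (\<Sum>p\<in>V. of_bool ((col(v := j)) p = a)) + (of_bool (j = a) :: nat)"
      unfolding col'_def by (rule sum_of_bool_fun_upd[OF finite_V wV])
    moreover have "(\<Sum>p\<in>V. of_bool ((col(v := j)) p = a)) + of_bool (col v = a)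
        = (\<Sum>p\<in>V. of_bool (col p = a)) + (of_bool (j = a) :: nat)"
      by (rule sum_of_bool_fun_upd[OF finite_V vV])
    ultimately show "(\<Sum>p\<in>V. of_bool (col' p = a)) + 2 * (\<Sum>t<Suc k. of_bool (\<tau> t = a))
      = fact (n - 1) + 2 * (\<Sum>t<Suc k. of_bool (exch (\<tau> t) = a) :: nat)"
      using bal[rule_format, OF a] wy colv colw by (simp add: i_def[symmetric] j_def[symmetric])
  qed
  have "insert B X \<subseteq> orbit \<sigma> ` V" using X(1) yV unfolding B_def by blast
  then have "glued \<tau> (Suc k) (insert B X) g col'"
    unfolding glued_def by (intro conjI card' cyc' col_g used' bal')
  then show ?case by blast
qed

text \<open>The colors given up and the colors gained have to agree as multisets.
  \<open>exch\<close> permutes the blocks \<open>2, 4\<close> and \<open>1, 3, 5\<close>, and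
  lengths 2 and 3 add up to any \<open>m\<close> from 2 on.\<close>

lemma balanced_types:
  fixes m :: nat
  assumes "2 \<le> m"
  obtains \<tau> where "\<And>t. \<tau> t \<in> {1..5}"
    "\<And>a. (\<Sum>t<m. of_bool (\<tau> t = a)) = (\<Sum>t<m. of_bool (exch (\<tau> t) = a) :: nat)"
proof (cases "even m")
  case True
  then obtain q where q: "m = 0 + 2 * q" by (metis add_0 evenE)
  define \<tau> :: "nat \<Rightarrow> nat" where "\<tau> t = (if even t then 2 else 4)" for t
  have \<tau>: "\<tau> (0 + 2 * r) = 2" "\<tau> (Suc (0 + 2 * r)) = 4" for r by (simp_all add: \<tau>_def)
  have J24: "exch 2 = 4" "exch 4 = 2" by (simp_all add: exch_def)
  have "(\<Sum>t<m. of_bool (\<tau> t = a)) = (\<Sum>t<m. of_bool (exch (\<tau> t) = a) :: nat)" for a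
    unfolding q by (rule sum_eq_by_pairs) (simp_all only: \<tau> J24 add.commute lessThan_0 sum.empty)
  moreover have "\<tau> t \<in> {1..5}" for t by (simp add: \<tau>_def)
  ultimately show thesis using that by blast
next
  case False
  then obtain r where r: "m = 2 * r + 1" by (elim oddE)
  then have q: "m = 3 + 2 * (r - 1)" using assms by simp
  \<comment> \<open>\<open>2 * t + 1\<close> lists 1, 3, 5; the pairs then start at the odd index 3,
    so each of them is \<open>4, 2\<close>.\<close>
  define \<tau> :: "nat \<Rightarrow> nat" where
    "\<tau> t = (if t < 3 then 2 * t + 1 else if even t then 2 else 4)" for t
  have \<tau>: "\<tau> (3 + 2 * r) = 4" "\<tau> (Suc (3 + 2 * r)) = 2" for r by (simp_all add: \<tau>_def)
  have J24: "exch 2 = 4" "exch 4 = 2" by (simp_all add: exch_def)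
  have three: "(\<Sum>t<3. F t) = F 0 + F 1 + F 2" for F :: "nat \<Rightarrow> nat"
    by (simp add: numeral_3_eq_3 numeral_2_eq_2)
  have \<tau>3: "\<tau> 0 = 1" "\<tau> 1 = 3" "\<tau> 2 = 5" by (simp_all add: \<tau>_def)
  have J3: "exch 1 = 3" "exch 3 = 5" "exch 5 = 1" by (simp_all add: exch_def)
  have "(\<Sum>t<m. of_bool (\<tau> t = a)) = (\<Sum>t<m. of_bool (exch (\<tau> t) = a) :: nat)" for a
    unfolding q
  proof (rule sum_eq_by_pairs)
    show "(\<Sum>t<3. of_bool (\<tau> t = a)) = (\<Sum>t<3. of_bool (exch (\<tau> t) = a) :: nat)"
      unfolding three \<tau>3 J3 by (simp only: ac_simps)
  qed (simp_all only: \<tau> J24 add.commute)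
  moreover have "\<tau> t \<in> {1..5}" for t by (auto simp: \<tau>_def)
  ultimately show thesis using that by blast
qed

lemma balanced_gray_code: "\<exists>ps cs. balanced_cadj_gray_code n ps cs"
proof -
  \<comment> \<open>Joining all orbits takes one merge fewer than there are orbits.\<close>
  let ?m = "card (orbit \<sigma> ` V) - 1"
  have m: "2 \<le> ?m" "?m < card (orbit \<sigma> ` V)" "Suc ?m = card (orbit \<sigma> ` V)"
    using three_orbits by linarith+
  obtain \<tau> where \<tau>: "\<And>t. \<tau> t \<in> {1..5}"
    "\<And>a. (\<Sum>t<?m. of_bool (\<tau> t = a)) = (\<Sum>t<?m. of_bool (exch (\<tau> t) = a) :: nat)"
    using balanced_types[OF m(1)] by metis
  obtain X f col where state: "glued \<tau> ?m X f col"
    using glue_orbits[of \<tau>, OF \<tau>(1) m(2)] by blast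
  have X: "X \<subseteq> orbit \<sigma> ` V" "card X = Suc ?m"
    and cyc: "cyclic_on f (\<Union>X)" and col: "\<forall>p\<in>V. col p \<in> N \<and> f p = p \<circ> s (col p)"
    and bal: "\<forall>a\<in>N. (\<Sum>p\<in>V. of_bool (col p = a)) + 2 * (\<Sum>t<?m. of_bool (\<tau> t = a))
      = fact (n - 1) + 2 * (\<Sum>t<?m. of_bool (exch (\<tau> t) = a) :: nat)"
    using state unfolding glued_def by - (elim conjE, assumption)+
  have "X = orbit \<sigma> ` V" using X m(3) finite_V by (metis card_subset_eq finite_imageI)
  then have "\<Union>X = V"
    using permutes_orbit_subset[OF \<sigma>_permutes] in_orbit_\<sigma> by blast
  then have cycV: "cyclic_on f V" using cyc by (simp only:)
  have "(\<Sum>p\<in>V. of_bool (col p = a)) = (fact (n - 1) :: nat)" if "a \<in> {1..n}" for a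
    using bal[rule_format, of a] that unfolding \<tau>(2)[of a] N_def by simp
  moreover have "f p = p \<circ> s (col p)" "col p \<in> {1..n}" if "p \<in> V" for p
    using col that unfolding N_def by blast+
  ultimately show ?thesis using cycV by (intro balanced_cadj_gray_codeI)
qed

end

theorem theorem2p3:
  fixes n :: nat
  assumes "n > 0" and "even n"
  shows "fact n / real n = fact (n - 1) \<and>
         (\<exists>ps cs. balanced_cadj_gray_code n ps cs)"
proof
  show "fact n / real n = fact (n - 1)"
    using assms(1) fact_reduce[of n, where 'a = real] by simp
  have "n = 2 \<or> n = 4 \<or> 6 \<le> n" using assms by presburger
  then show "\<exists>ps cs. balanced_cadj_gray_code n ps cs"
  proof (elim disjE)
    assume "6 \<le> n"
    then interpret cadj_graph n using assms(2) by unfold_locales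
    show ?thesis by (rule balanced_gray_code)
  qed (use balanced_gray_code_2 balanced_gray_code_4 in blast)+
qed

end
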